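(* Let $A$ and $B$ be $C^*$-algebras and let $\varphi : A^+ \to B^+$ be a map (not assumed linear or additive). If $\varphi$ is concave, then $\varphi$ is monotone.
   Context: For a $C^*$-algebra $A$, $A^+$ denotes the cone of all positive elements. A map $\varphi : A^+ \to B^+$ is called monotone if $x \leq y$ implies $\varphi(x) \leq \varphi(y)$ for all $x, y \in A^+$. It is called concave if $\varphi(tx + (1-t)y) \geq t\varphi(x) + (1-t)\varphi(y)$ for all $x, y \in A^+$ and $t \in [0,1]$. *)

theory Defs
  imports "HOL-Analysis.Analysis"
begin

text \<open>
  Complex C*-algebras, not necessarily unital. The real Banach algebra structure comes from the
  library classes; \<open>scaleR_scaleC\<close> ties it to the complex one. The zero algebra is allowed.
\<close>

class cstar_algebra = real_normed_algebra + banach +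
  fixes scaleC :: "complex \<Rightarrow> 'a \<Rightarrow> 'a" (infixr \<open>*\<^sub>C\<close> 75)
    and star :: "'a \<Rightarrow> 'a"
  assumes scaleC_add_right: "c *\<^sub>C (x + y) = c *\<^sub>C x + c *\<^sub>C y"
    and scaleC_add_left: "(c + d) *\<^sub>C x = c *\<^sub>C x + d *\<^sub>C x"
    and scaleC_scaleC: "c *\<^sub>C (d *\<^sub>C x) = (c * d) *\<^sub>C x"
    and scaleR_scaleC: "r *\<^sub>R x = complex_of_real r *\<^sub>C x"
    and mult_scaleC_left: "(c *\<^sub>C x) * y = c *\<^sub>C (x * y)"
    and mult_scaleC_right: "x * (c *\<^sub>C y) = c *\<^sub>C (x * y)"
    and norm_scaleC: "norm (c *\<^sub>C x) = cmod c * norm x"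
    and star_add: "star (x + y) = star x + star y"
    and star_scaleC: "star (c *\<^sub>C x) = cnj c *\<^sub>C star x"
    and star_mult: "star (x * y) = star y * star x"
    and star_star: "star (star x) = x"
    and cstar_identity: "norm (star x * x) = (norm x)\<^sup>2"

definition is_identity :: "'a::cstar_algebra \<Rightarrow> bool" where
  "is_identity e \<longleftrightarrow> (\<forall>x. e * x = x \<and> x * e = x)"

text \<open>
  Multiplication of the unitization: the pair \<open>(a, \<alpha>)\<close> stands for \<open>a + \<alpha>1\<close>, and the unit is
  \<open>(0, 1)\<close>. Only its algebra structure is needed to define the spectrum.
\<close>

fun unitization_mult ::
    "'a::cstar_algebra \<times> complex \<Rightarrow> 'a \<times> complex \<Rightarrow> 'a \<times> complex" where
  "unitization_mult (a, \<alpha>) (b, \<beta>) = (a * b + \<alpha> *\<^sub>C b + \<beta> *\<^sub>C a, \<alpha> * \<beta>)"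

text \<open>
  The spectrum of \<open>a\<close>: the \<open>z\<close> for which \<open>z \<cdot> 1 - a\<close> is not invertible, computed in the algebra
  itself if it is unital and in its unitization otherwise.
\<close>

definition spectrum :: "'a::cstar_algebra \<Rightarrow> complex set" where
  "spectrum a =
    (if \<exists>e::'a. is_identity e
     then let e = (THE e. is_identity e) in
       {z. \<not> (\<exists>b. (z *\<^sub>C e - a) * b = e \<and> b * (z *\<^sub>C e - a) = e)}
     else
       {z. \<not> (\<exists>u. unitization_mult (- a, z) u = (0, 1) \<and> unitization_mult u (- a, z) = (0, 1))})"

definition positive_cone :: "'a::cstar_algebra set" where
  "positive_cone = {a. star a = a \<and> spectrum a \<subseteq> \<real>\<^sub>\<ge>\<^sub>0}"

definition cstar_le :: "'a::cstar_algebra \<Rightarrow> 'a \<Rightarrow> bool" (infix \<open>\<preceq>\<close> 50) where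
  "x \<preceq> y \<longleftrightarrow> y - x \<in> positive_cone"

definition cstar_monotone :: "('a::cstar_algebra \<Rightarrow> 'b::cstar_algebra) \<Rightarrow> bool" where
  "cstar_monotone \<phi> \<longleftrightarrow> monotone_on positive_cone (\<preceq>) (\<preceq>) \<phi>"

definition cstar_concave :: "('a::cstar_algebra \<Rightarrow> 'b::cstar_algebra) \<Rightarrow> bool" where
  "cstar_concave \<phi> \<longleftrightarrow>
    (\<forall>x\<in>positive_cone. \<forall>y\<in>positive_cone. \<forall>t\<in>{0..1::real}.
      t *\<^sub>R \<phi> x + (1 - t) *\<^sub>R \<phi> y \<preceq> \<phi> (t *\<^sub>R x + (1 - t) *\<^sub>R y))"

end

theory Submission
  imports Defs
begin

text \<open>
  If \<open>x \<preceq> y\<close> and \<open>0 \<le> t < 1\<close>, then \<open>y = t x + (1 - t) u\<close> with \<open>u = x + (y - x) / (1 - t)\<close> positive, so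
  concavity gives \<open>t \<phi> x \<preceq> \<phi> y\<close>; let \<open>t\<close> tend to 1. This needs that the positive cone is convex and
  closed, which is clear once positivity of a self-adjoint \<open>a\<close> is expressed as
  \<open>\<parallel>s x - a x\<parallel> \<le> s \<parallel>x\<parallel>\<close> for all \<open>x\<close>, where \<open>s \<ge> \<parallel>a\<parallel>\<close>.

  If the operator \<open>1 - a / s\<close> had norm above 1 for a positive \<open>a\<close>, it could be scaled to a symmetric
  operator \<open>T\<close> of norm 1 for which \<open>1 - T\<^sup>2\<close> is bounded below. Iterating \<open>2 \<parallel>T x\<parallel> \<le> \<parallel>x + T\<^sup>2 x\<parallel>\<close>
  along \<open>1 - T\<^bsup>2n\<^esup> = (1 - T\<^sup>2)(1 + T\<^sup>2)(1 + T\<^sup>4)\<cdots>(1 + T\<^sup>n)\<close> with \<open>n = 2\<^sup>m\<close> shows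
  \<open>\<parallel>T\<^bsup>n-1\<^esup>\<parallel> = O(1/n)\<close>, whereas \<open>\<parallel>T\<^sup>n\<parallel> = 1\<close> by the C*-identity. Conversely, the norm
  condition makes \<open>z y - a y = -a\<close> solvable by a contraction argument for every \<open>z\<close> outside
  \<open>[0, \<infinity>)\<close>.
\<close>

section \<open>Elementary rules for complex scalars and the involution\<close>

lemma scaleC_one [simp]: "1 *\<^sub>C x = (x::'a::cstar_algebra)"
  by (metis of_real_1 scaleR_one scaleR_scaleC)

lemma scaleC_zero_left [simp]: "0 *\<^sub>C x = (0::'a::cstar_algebra)"
  by (metis of_real_0 scaleR_zero_left scaleR_scaleC)

lemma scaleC_zero_right [simp]: "c *\<^sub>C 0 = (0::'a::cstar_algebra)"
  by (metis add_cancel_right_right scaleC_add_right add_0)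

lemma scaleC_minus_right [simp]: "c *\<^sub>C (- x) = - (c *\<^sub>C x :: 'a::cstar_algebra)"
  by (metis add.right_inverse minus_unique scaleC_add_right scaleC_zero_right)

lemma scaleC_minus_left [simp]: "(- c) *\<^sub>C x = - (c *\<^sub>C x :: 'a::cstar_algebra)"
  by (metis add.right_inverse minus_unique scaleC_add_left scaleC_zero_left)

lemma scaleC_diff_right: "c *\<^sub>C (x - y) = c *\<^sub>C x - c *\<^sub>C (y::'a::cstar_algebra)"
  by (metis diff_conv_add_uminus scaleC_add_right scaleC_minus_right)

lemma scaleC_diff_left: "(c - d) *\<^sub>C x = c *\<^sub>C x - d *\<^sub>C (x::'a::cstar_algebra)"
  by (metis diff_conv_add_uminus scaleC_add_left scaleC_minus_left)

lemmas scaleC_simps = scaleC_add_right scaleC_add_left scaleC_diff_right scaleC_diff_left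
  scaleC_scaleC mult_scaleC_left mult_scaleC_right

lemma star_zero [simp]: "star 0 = (0::'a::cstar_algebra)"
  by (metis add_cancel_right_right star_add add_0)

lemma star_minus [simp]: "star (- x) = - star (x::'a::cstar_algebra)"
  by (metis add.right_inverse minus_unique star_add star_zero)

lemma star_diff: "star (x - y) = star x - star (y::'a::cstar_algebra)"
  by (metis diff_conv_add_uminus star_add star_minus)

lemma star_scaleR: "star (r *\<^sub>R x) = r *\<^sub>R star (x::'a::cstar_algebra)"
  by (simp add: scaleR_scaleC star_scaleC)

lemma norm_star: "norm (star x) = norm (x::'a::cstar_algebra)"
proof -
  have le: "norm x \<le> norm (star x)" for x :: 'a
  proof (cases "norm x = 0")
    case False
    have "norm x * norm x \<le> norm (star x) * norm x"
      using norm_mult_ineq [of "star x" x] by (simp add: cstar_identity power2_eq_square)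
    with False show ?thesis by simp
  qed simp
  from le [of x] le [of "star x"] show ?thesis by (simp add: star_star)
qed

lemma bounded_linear_star: "bounded_linear (star :: 'a::cstar_algebra \<Rightarrow> 'a)"
  by (rule bounded_linear_intro [where K = 1])
    (simp_all add: star_add star_scaleR norm_star)

section \<open>Resolvents expressed inside the algebra\<close>

text \<open>For \<open>z \<noteq> 0\<close> the element \<open>y\<close> below is the one with \<open>(z - a)\<^sup>-\<^sup>1 = (1 - y) / z\<close>; it lies in the
  algebra itself, so that the unital and the non-unital case need not be distinguished.\<close>

definition quasi_inverse :: "complex \<Rightarrow> 'a::cstar_algebra \<Rightarrow> 'a \<Rightarrow> bool" where
  "quasi_inverse z a y \<longleftrightarrow> z *\<^sub>C y - a * y = - a \<and> z *\<^sub>C y - y * a = - a"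

lemma is_identity_unique: "is_identity e \<Longrightarrow> is_identity f \<Longrightarrow> e = f"
  unfolding is_identity_def by metis

lemma notin_spectrum_iff:
  fixes a :: "'a::cstar_algebra"
  assumes "z \<noteq> 0"
  shows "z \<notin> spectrum a \<longleftrightarrow> (\<exists>y. quasi_inverse z a y)"
proof (cases "\<exists>e::'a. is_identity e")
  case True
  then obtain e :: 'a where e: "is_identity e" by blast
  have the_e: "(THE e::'a. is_identity e) = e"
    using e is_identity_unique by blast
  have [simp]: "e * x = x" "x * e = x" for x
    using e by (auto simp: is_identity_def)
  have "(\<exists>b. (z *\<^sub>C e - a) * b = e \<and> b * (z *\<^sub>C e - a) = e) \<longleftrightarrow> (\<exists>y. quasi_inverse z a y)"
  proof
    assume "\<exists>b. (z *\<^sub>C e - a) * b = e \<and> b * (z *\<^sub>C e - a) = e"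
    then obtain b where b: "z *\<^sub>C b - a * b = e" "z *\<^sub>C b - b * a = e"
      by (auto simp: left_diff_distrib right_diff_distrib mult_scaleC_left mult_scaleC_right)
    have "z *\<^sub>C (e - z *\<^sub>C b) - a * (e - z *\<^sub>C b) = z *\<^sub>C e - a - z *\<^sub>C (z *\<^sub>C b - a * b)"
      "z *\<^sub>C (e - z *\<^sub>C b) - (e - z *\<^sub>C b) * a = z *\<^sub>C e - a - z *\<^sub>C (z *\<^sub>C b - b * a)"
      by (simp_all add: algebra_simps scaleC_simps)
    with b have "quasi_inverse z a (e - z *\<^sub>C b)"
      by (simp add: quasi_inverse_def)
    then show "\<exists>y. quasi_inverse z a y" ..
  next
    assume "\<exists>y. quasi_inverse z a y"
    then obtain y where y: "z *\<^sub>C y - a * y = - a" "z *\<^sub>C y - y * a = - a"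
      by (auto simp: quasi_inverse_def)
    let ?b = "inverse z *\<^sub>C (e - y)"
    have "(z *\<^sub>C e - a) * ?b = inverse z *\<^sub>C (z *\<^sub>C e - a - (z *\<^sub>C y - a * y))"
      "?b * (z *\<^sub>C e - a) = inverse z *\<^sub>C (z *\<^sub>C e - a - (z *\<^sub>C y - y * a))"
      by (simp_all add: algebra_simps scaleC_simps)
    with y assms have "(z *\<^sub>C e - a) * ?b = e \<and> ?b * (z *\<^sub>C e - a) = e"
      by (simp add: scaleC_scaleC)
    then show "\<exists>b. (z *\<^sub>C e - a) * b = e \<and> b * (z *\<^sub>C e - a) = e" ..
  qed
  with True the_e show ?thesis
    by (simp add: spectrum_def)
next
  case False
  have "(\<exists>u. unitization_mult (- a, z) u = (0, 1) \<and> unitization_mult u (- a, z) = (0, 1))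
      \<longleftrightarrow> (\<exists>y. quasi_inverse z a y)" (is "?L \<longleftrightarrow> _")
  proof
    assume ?L
    then obtain b \<beta> where "unitization_mult (- a, z) (b, \<beta>) = (0, 1)"
        "unitization_mult (b, \<beta>) (- a, z) = (0, 1)"
      by auto
    then have b: "z *\<^sub>C b - a * b = \<beta> *\<^sub>C a" "z *\<^sub>C b - b * a = \<beta> *\<^sub>C a" "z * \<beta> = 1"
      by (auto simp: algebra_simps eq_neg_iff_add_eq_0 add_eq_0_iff)
    \<comment> \<open>The inverse in the unitization is \<open>(b, 1/z)\<close>; comparing it with
      \<open>(1 - y) / z\<close> gives \<open>y = - z b\<close>.\<close>
    have "z *\<^sub>C (- (z *\<^sub>C b)) - a * (- (z *\<^sub>C b)) = - (z *\<^sub>C (z *\<^sub>C b - a * b))"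
      "z *\<^sub>C (- (z *\<^sub>C b)) - (- (z *\<^sub>C b)) * a = - (z *\<^sub>C (z *\<^sub>C b - b * a))"
      by (simp_all add: algebra_simps scaleC_simps)
    with b have "quasi_inverse z a (- (z *\<^sub>C b))"
      by (simp add: quasi_inverse_def scaleC_scaleC)
    then show "\<exists>y. quasi_inverse z a y" ..
  next
    assume "\<exists>y. quasi_inverse z a y"
    then obtain y where y: "z *\<^sub>C y - a * y = - a" "z *\<^sub>C y - y * a = - a"
      by (auto simp: quasi_inverse_def)
    let ?b = "- (inverse z *\<^sub>C y)"
    have "- a * ?b + z *\<^sub>C ?b = - (inverse z *\<^sub>C (z *\<^sub>C y - a * y))"
      "?b * (- a) + z *\<^sub>C ?b = - (inverse z *\<^sub>C (z *\<^sub>C y - y * a))"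
      by (simp_all add: algebra_simps scaleC_simps)
    with y have "- a * ?b + z *\<^sub>C ?b = inverse z *\<^sub>C a" "?b * (- a) + z *\<^sub>C ?b = inverse z *\<^sub>C a"
      by simp_all
    then have "- a * ?b + z *\<^sub>C ?b + inverse z *\<^sub>C (- a) = 0"
        "?b * (- a) + inverse z *\<^sub>C (- a) + z *\<^sub>C ?b = 0"
      by (simp_all add: algebra_simps)
    with assms have "unitization_mult (- a, z) (?b, inverse z) = (0, 1)"
        "unitization_mult (?b, inverse z) (- a, z) = (0, 1)"
      by (simp_all only: unitization_mult.simps) simp_all
    then show ?L by blast
  qed
  then show ?thesis
    unfolding spectrum_def if_not_P [OF False] mem_Collect_eq not_not .
qed

text \<open>Restricting to \<open>z\<close> different from 0 costs nothing, since 0 is itself a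
  nonnegative real.\<close>

lemma positive_cone_iff_quasi_inverse:
  "a \<in> positive_cone \<longleftrightarrow> star a = a \<and> (\<forall>z. z \<notin> \<real>\<^sub>\<ge>\<^sub>0 \<longrightarrow> (\<exists>y. quasi_inverse z a y))"
proof -
  have "z \<noteq> 0" if "z \<notin> \<real>\<^sub>\<ge>\<^sub>0" for z :: complex
    using that by auto
  then show ?thesis
    unfolding positive_cone_def using notin_spectrum_iff by blast
qed

section \<open>Elements with nonnegative spectrum are norm positive\<close>

text \<open>Self-adjointness for the algebra-valued inner product \<open>star x * y\<close>, that
  is, with the algebra viewed as a Hilbert module over itself.\<close>

definition symmetric_operator :: "('a::cstar_algebra \<Rightarrow> 'a) \<Rightarrow> bool" where
  "symmetric_operator T \<longleftrightarrow> (\<forall>x y. T (x + y) = T x + T y) \<and> (\<forall>c x. T (c *\<^sub>C x) = c *\<^sub>C T x) \<and>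
    (\<forall>x y. star (T x) * y = star x * T y)"

lemma symmetric_operator_funpow:
  assumes "symmetric_operator T"
  shows "symmetric_operator (T ^^ n)"
  using assms
  by (induction n) (auto simp: symmetric_operator_def funpow_swap1)

text \<open>Cauchy-Schwarz for this inner product, applied to
  \<open>star (T x) * T x = star x * T (T x)\<close>.\<close>

lemma symmetric_operator_norm_sq_le:
  assumes "symmetric_operator T"
  shows "(norm (T x))\<^sup>2 \<le> norm x * norm (T (T x))"
proof -
  have "(norm (T x))\<^sup>2 = norm (star x * T (T x))"
    using assms by (simp add: cstar_identity [symmetric] symmetric_operator_def)
  also have "\<dots> \<le> norm x * norm (T (T x))"
    using norm_mult_ineq [of "star x"] by (simp add: norm_star)
  finally show ?thesis .
qed

text \<open>The operators \<open>1 + \<i>T\<close> and \<open>1 - \<i>T\<close> are adjoint to each other and commute, so they have the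
  same norm on every vector; and \<open>(1 + \<i>T)\<^sup>2 - (1 - \<i>T)\<^sup>2 = 4\<i>T\<close>, \<open>(1 + \<i>T)(1 - \<i>T) = 1 + T\<^sup>2\<close>.\<close>

lemma symmetric_operator_am_gm:
  assumes "symmetric_operator T"
  shows "2 * norm (T x) \<le> norm (x + T (T x))"
proof -
  have add: "T (x + y) = T x + T y" and scale: "T (c *\<^sub>C x) = c *\<^sub>C T x"
    and sym: "star (T x) * y = star x * T y" for x y c
    using assms by (auto simp: symmetric_operator_def)
  have minus: "T (- x) = - T x" for x
    using scale [of "-1" x] by simp
  have diff: "T (x - y) = T x - T y" for x y
    using add [of x "- y"] by (simp add: minus)
  note simps = algebra_simps scaleC_simps add diff scale minus
  let ?P = "\<lambda>x. x + \<i> *\<^sub>C T x" and ?M = "\<lambda>x. x - \<i> *\<^sub>C T x"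
  \<comment> \<open>Both sides equal \<open>star z * z + star (T z) * T z\<close>: symmetry cancels
    the cross terms.\<close>
  have "star (?P z) * ?P z = star (?M z) * ?M z" for z
    by (simp add: star_add star_diff star_scaleC simps sym)
  then have "norm (?P z) = norm (?M z)" for z
    by (metis cstar_identity norm_ge_zero power2_eq_iff_nonneg)
  moreover have "?M (?P x) = x + T (T x)" "?P (?M x) = x + T (T x)"
    by (simp_all add: simps)
  ultimately have "norm (?P (?P x)) = norm (x + T (T x))" "norm (?M (?M x)) = norm (x + T (T x))"
    by metis+
  moreover have "?P (?P x) - ?M (?M x) = (4 * \<i>) *\<^sub>C T x"
  proof -
    have "4 * \<i> = \<i> + \<i> + \<i> + \<i>" by simp
    then show ?thesis by (simp only: scaleC_add_left) (simp add: simps)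
  qed
  ultimately show ?thesis
    using norm_triangle_ineq4 [of "?P (?P x)" "?M (?M x)"] by (simp add: norm_scaleC norm_mult)
qed

lemma symmetric_operator_power_decay:
  assumes T: "symmetric_operator T" and below: "\<And>x. \<kappa> * norm x \<le> norm (x - T (T x))"
    and "\<kappa> \<ge> 0"
  shows "\<kappa> * 2 ^ m * norm ((T ^^ (2 ^ m - 1)) y) \<le> norm (y - (T ^^ (2 ^ Suc m)) y)"
proof (induction m arbitrary: y)
  case 0
  then show ?case using below by (simp add: numeral_2_eq_2)
next
  case (Suc m)
  have lin: "(T ^^ n) (x + y) = (T ^^ n) x + (T ^^ n) y" for n x y
    using symmetric_operator_funpow [OF T, of n] by (simp add: symmetric_operator_def)
  have comp: "(T ^^ k) ((T ^^ n) x) = (T ^^ (k + n)) x" for k n x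
    by (simp add: funpow_add)
  \<comment> \<open>Write n for \<open>2 ^ m\<close>. The induction hypothesis at z = (1 + T^(2n)) y
    has right side (1 - T^(4n)) y, and on the left T^(n-1) z = (1 + T^(2n)) w. The inequality for
    T^n at w then gains the factor 2, and T^n w = T^(2n-1) y.\<close>
  define z where "z = y + (T ^^ (2 ^ Suc m)) y"
  define w where "w = (T ^^ (2 ^ m - 1)) y"
  have "(T ^^ (2 ^ Suc m - 1)) y = (T ^^ (2 ^ m)) w"
    by (simp add: w_def comp) (metis Nat.add_diff_assoc mult_2 one_le_numeral one_le_power)
  moreover have "(T ^^ (2 ^ m - 1)) z = w + (T ^^ (2 ^ m)) ((T ^^ (2 ^ m)) w)"
    by (simp add: z_def w_def lin comp algebra_simps mult_2)
  moreover have "z - (T ^^ (2 ^ Suc m)) z = y - (T ^^ (2 ^ Suc (Suc m))) y"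
    by (simp add: z_def lin comp algebra_simps mult_2)
  ultimately have "\<kappa> * 2 ^ m * norm (w + (T ^^ (2 ^ m)) ((T ^^ (2 ^ m)) w))
      \<le> norm (y - (T ^^ (2 ^ Suc (Suc m))) y)"
    using Suc.IH [of z] by simp
  moreover have "\<kappa> * 2 ^ m * (2 * norm ((T ^^ (2 ^ m)) w))
      \<le> \<kappa> * 2 ^ m * norm (w + (T ^^ (2 ^ m)) ((T ^^ (2 ^ m)) w))"
    using symmetric_operator_am_gm [OF symmetric_operator_funpow [OF T]] \<open>\<kappa> \<ge> 0\<close>
    by (intro mult_left_mono) auto
  ultimately show ?case
    using \<open>(T ^^ (2 ^ Suc m - 1)) y = (T ^^ (2 ^ m)) w\<close> by (simp add: mult.assoc)
qed

text \<open>Halving the exponent replaces the bound q by its square root, by the Cauchy-Schwarz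
  estimate for the powers of T, and the root stays below 1.\<close>

lemma symmetric_operator_contraction_root:
  assumes T: "symmetric_operator T" and "0 \<le> q" "q < 1"
    and "\<And>x. norm ((T ^^ (2 ^ m)) x) \<le> q * norm x"
  shows "\<exists>r. 0 \<le> r \<and> r < 1 \<and> (\<forall>x. norm (T x) \<le> r * norm x)"
  using assms(2-)
proof (induction m arbitrary: q)
  case 0
  then show ?case by auto
next
  case (Suc m)
  let ?S = "T ^^ (2 ^ m)"
  have "norm (?S x) \<le> sqrt q * norm x" for x
  proof (rule power2_le_imp_le)
    have "(norm (?S x))\<^sup>2 \<le> norm x * norm (?S (?S x))"
      by (intro symmetric_operator_norm_sq_le symmetric_operator_funpow T)
    also have "?S (?S x) = (T ^^ (2 ^ Suc m)) x"
      by (simp add: mult_2 funpow_add)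
    also have "norm x * norm \<dots> \<le> norm x * (q * norm x)"
      using Suc.prems by (intro mult_left_mono) auto
    finally show "(norm (?S x))\<^sup>2 \<le> (sqrt q * norm x)\<^sup>2"
      using Suc.prems by (simp add: power_mult_distrib) (simp add: power2_eq_square ac_simps)
  qed (use Suc.prems in simp)
  with Suc.IH [of "sqrt q"] Suc.prems show ?case by simp
qed

lemma symmetric_operator_strict_contraction:
  assumes T: "symmetric_operator T" and contr: "\<And>x. norm (T x) \<le> norm x"
    and "\<kappa> > 0" and below: "\<And>x. \<kappa> * norm x \<le> norm (x - T (T x))"
  shows "\<exists>r. 0 \<le> r \<and> r < 1 \<and> (\<forall>x. norm (T x) \<le> r * norm x)"
proof -
  have pow: "norm ((T ^^ n) x) \<le> norm x" for n x
    by (induction n) (auto intro: order_trans [OF contr])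
  \<comment> \<open>Powers of T are contractions, so the decay estimate is bounded by
    \<open>2 * norm x\<close>; this choice of m then makes the norm of T^(2^m - 1) at most
    1/2.\<close>
  obtain m where m: "4 / \<kappa> < 2 ^ m"
    using real_arch_pow [of 2 "4 / \<kappa>"] by auto
  have "norm ((T ^^ (2 ^ m)) x) \<le> 1 / 2 * norm x" for x
  proof -
    have "norm ((T ^^ (2 ^ m)) x) \<le> norm ((T ^^ (2 ^ m - 1)) x)"
    proof -
      have "(T ^^ (2 ^ m)) x = T ((T ^^ (2 ^ m - 1)) x)"
        by (metis Suc_diff_1 comp_apply funpow.simps(2) pos2 zero_less_power)
      then show ?thesis using contr by simp
    qed
    moreover have "\<kappa> * 2 ^ m * norm ((T ^^ (2 ^ m - 1)) x) \<le> 2 * norm x"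
      using symmetric_operator_power_decay [OF T below, of m x] \<open>\<kappa> > 0\<close> pow [of "2 ^ Suc m" x]
        norm_triangle_ineq4 [of x "(T ^^ (2 ^ Suc m)) x"] by linarith
    moreover have "4 * norm ((T ^^ (2 ^ m - 1)) x) \<le> \<kappa> * 2 ^ m * norm ((T ^^ (2 ^ m - 1)) x)"
      using m \<open>\<kappa> > 0\<close> by (intro mult_right_mono) (auto simp: field_simps)
    ultimately show ?thesis by simp
  qed
  then show ?thesis
    by (intro symmetric_operator_contraction_root [OF T, of "1 / 2"]) auto
qed

text \<open>Left multiplication by z - a has the left inverse (1 - y) / z, whose norm is at most (1
  + \<open>norm y\<close>) / |z|.\<close>

lemma quasi_inverse_bounded_below:
  fixes a :: "'a::cstar_algebra"
  assumes "quasi_inverse z a y" and "z \<noteq> 0"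
  obtains \<kappa> where "\<kappa> > 0" and "\<And>x. \<kappa> * norm x \<le> norm (z *\<^sub>C x - a * x)"
proof
  have pos: "1 + norm y > 0"
    by (simp add: add_pos_nonneg)
  then show "cmod z / (1 + norm y) > 0"
    using \<open>z \<noteq> 0\<close> by simp
  fix x
  let ?w = "z *\<^sub>C x - a * x"
  have "?w - y * ?w = z *\<^sub>C x - a * x - (z *\<^sub>C y - y * a) * x"
    by (simp add: algebra_simps scaleC_simps)
  also have "\<dots> = z *\<^sub>C x"
    using assms by (simp add: quasi_inverse_def)
  finally have "cmod z * norm x = norm (?w - y * ?w)"
    by (simp only: norm_scaleC)
  also have "\<dots> \<le> norm ?w + norm (y * ?w)"
    by (rule norm_triangle_ineq4)
  also have "\<dots> \<le> (1 + norm y) * norm ?w"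
    using norm_mult_ineq [of y ?w] by (simp add: algebra_simps)
  finally show "cmod z / (1 + norm y) * norm x \<le> norm ?w"
    using pos by (simp add: field_simps)
qed

lemma positive_cone_norm_le:
  fixes a :: "'a::cstar_algebra"
  assumes a: "a \<in> positive_cone" and s: "s > 0" "norm a \<le> s"
  shows "norm (s *\<^sub>R x - a * x) \<le> s * norm x"
proof -
  define c where "c x = x - (1 / s) *\<^sub>R (a * x)" for x
  have blin: "bounded_linear c"
    unfolding c_def
    by (intro bounded_linear_sub bounded_linear_ident
        bounded_linear_scaleR_right [THEN bounded_linear_compose] bounded_linear_mult_right)
  define K where "K = onorm c"
  have K: "norm (c x) \<le> K * norm x" for x
    unfolding K_def by (rule onorm [OF blin])
  have "K \<le> 1"
  proof (rule ccontr)
    assume "\<not> K \<le> 1"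
    \<comment> \<open>K is the operator norm of 1 - a/s, so this factor rescales that operator to
      norm 1.\<close>
    define \<tau> where "\<tau> = 1 / K"
    have \<tau>: "0 < \<tau>" "\<tau> < 1"
      using \<open>\<not> K \<le> 1\<close> by (auto simp: \<tau>_def)
    define T where "T x = \<tau> *\<^sub>R c x" for x
    have sa: "star a = a"
      using a by (simp add: positive_cone_def)
    have T_eq: "T x = \<tau> *\<^sub>R x - (\<tau> / s) *\<^sub>R (a * x)" for x
      by (simp add: T_def c_def algebra_simps)
    have "symmetric_operator T"
      unfolding symmetric_operator_def T_eq
      by (auto simp: algebra_simps scaleR_scaleC scaleC_simps star_diff star_mult star_scaleC sa)
    moreover have "norm (T x) \<le> norm x" for x
      using K [of x] \<open>\<not> K \<le> 1\<close> by (simp add: T_def \<tau>_def field_simps)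
    moreover have "\<exists>\<kappa>>0. \<forall>x. \<kappa> * norm x \<le> norm (x - T (T x))"
    proof -
      \<comment> \<open>Chosen so that 1 - T = -(\<tau>/s)(z - a). As z is negative, the
        quasi-inverse bounds 1 - T below.\<close>
      define z where "z = - ((1 - \<tau>) * s / \<tau>)"
      have "z < 0"
        using \<tau> s by (simp add: z_def)
      then have "complex_of_real z \<notin> \<real>\<^sub>\<ge>\<^sub>0" by simp
      with a have "\<exists>y. quasi_inverse (complex_of_real z) a y"
        unfolding positive_cone_iff_quasi_inverse by blast
      then obtain y where "quasi_inverse (complex_of_real z) a y" ..
      with \<open>z < 0\<close> obtain \<kappa> where "\<kappa> > 0" and
        \<kappa>: "\<And>x. \<kappa> * norm x \<le> norm (z *\<^sub>R x - a * x)"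
        by (metis of_real_eq_0_iff less_irrefl quasi_inverse_bounded_below scaleR_scaleC)
      have below1: "(\<tau> / s * \<kappa>) * norm x \<le> norm (x - T x)" for x
      proof -
        have "x - T x = - ((\<tau> / s) *\<^sub>R (z *\<^sub>R x - a * x))"
          using \<tau> s by (simp add: T_eq z_def algebra_simps diff_divide_distrib)
        then have "norm (x - T x) = (\<tau> / s) * norm (z *\<^sub>R x - a * x)"
          using \<tau> s by simp
        moreover have "(\<tau> / s) * (\<kappa> * norm x) \<le> (\<tau> / s) * norm (z *\<^sub>R x - a * x)"
          using \<tau> s \<kappa> by (intro mult_left_mono) auto
        ultimately show ?thesis by (simp add: mult.assoc)
      qed
      \<comment> \<open>1 + T = (1 + \<tau>) - (\<tau>/s) a, and the subtracted operator has norm at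
        most \<tau>. Combined with the bound for 1 - T this bounds 1 - T^2 below.\<close>
      have below2: "norm x \<le> norm (x + T x)" for x
      proof -
        have "norm ((\<tau> / s) *\<^sub>R (a * x)) = (\<tau> / s) * norm (a * x)"
          using \<tau> s by simp
        also have "\<dots> \<le> (\<tau> / s) * (s * norm x)"
          using \<tau> s by (intro mult_left_mono order_trans [OF norm_mult_ineq] mult_right_mono) auto
        also have "\<dots> = \<tau> * norm x"
          using s by simp
        finally have "norm ((1 + \<tau>) *\<^sub>R x) - \<tau> * norm x \<le> norm ((1 + \<tau>) *\<^sub>R x - (\<tau> / s) *\<^sub>R (a * x))"
          using norm_triangle_ineq2 [of "(1 + \<tau>) *\<^sub>R x" "(\<tau> / s) *\<^sub>R (a * x)"] by linarith
        moreover have "norm ((1 + \<tau>) *\<^sub>R x) = norm x + \<tau> * norm x"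
          using \<tau> by (simp add: distrib_right)
        moreover have "(1 + \<tau>) *\<^sub>R x - (\<tau> / s) *\<^sub>R (a * x) = x + T x"
          by (simp add: T_eq algebra_simps)
        ultimately show ?thesis by simp
      qed
      have "(\<tau> / s * \<kappa>) * norm x \<le> norm (x - T (T x))" for x
      proof -
        have "(\<tau> / s * \<kappa>) * norm x \<le> (\<tau> / s * \<kappa>) * norm (x + T x)"
          using \<tau> s \<open>\<kappa> > 0\<close> below2 by (intro mult_left_mono) auto
        also have "\<dots> \<le> norm ((x + T x) - T (x + T x))"
          by (rule below1)
        also have "(x + T x) - T (x + T x) = x - T (T x)"
          using \<open>symmetric_operator T\<close> by (simp add: symmetric_operator_def)
        finally show ?thesis .
      qed
      moreover have "\<tau> / s * \<kappa> > 0"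
        using \<tau> s \<open>\<kappa> > 0\<close> by simp
      ultimately show ?thesis by blast
    qed
    ultimately obtain r where r: "0 \<le> r" "r < 1" "\<And>x. norm (T x) \<le> r * norm x"
      using symmetric_operator_strict_contraction by metis
    \<comment> \<open>Undoing the scaling bounds c by r K < K, although K is its least
      bound.\<close>
    have "norm (c x) \<le> r * K * norm x" for x
      using r(3) [of x] \<open>\<not> K \<le> 1\<close> by (simp add: T_def \<tau>_def field_simps)
    then have "K \<le> r * K"
      using onorm_bound [of "r * K" c] r(1) \<open>\<not> K \<le> 1\<close> by (simp add: K_def)
    with r \<open>\<not> K \<le> 1\<close> show False
      by (simp add: mult_le_cancel_right2)
  qed
  have "norm (s *\<^sub>R x - a * x) = s * norm (c x)"
  proof -
    have "s *\<^sub>R x - a * x = s *\<^sub>R c x"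
      using s by (simp add: c_def algebra_simps)
    then show ?thesis using s by simp
  qed
  also have "\<dots> \<le> s * norm x"
    using K [of x] mult_right_mono [OF \<open>K \<le> 1\<close>, of "norm x"] s by (intro mult_left_mono) auto
  finally show ?thesis .
qed

section \<open>Norm positive elements have nonnegative spectrum\<close>

text \<open>The equation reads (z - p) y = (a - p) y - a. Outside the disc of radius \<rho> about p,
  dividing by z - p makes it a fixed point problem for a contraction.\<close>

lemma ex_right_quasi_inverse:
  fixes a :: "'a::cstar_algebra"
  assumes "\<rho> \<ge> 0" "\<rho> < cmod (z - p)" and bound: "\<And>x. norm (a * x - p *\<^sub>C x) \<le> \<rho> * norm x"
  shows "\<exists>y. z *\<^sub>C y - a * y = - a"
proof -
  define w where "w = z - p"
  have w: "w \<noteq> 0"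
    using assms by (auto simp: w_def)
  define f where "f y = inverse w *\<^sub>C (a * y - p *\<^sub>C y - a)" for y
  have "dist (f x) (f y) \<le> (\<rho> / cmod w) * dist x y" for x y
  proof -
    have "f x - f y = inverse w *\<^sub>C (a * (x - y) - p *\<^sub>C (x - y))"
      by (simp add: f_def algebra_simps scaleC_simps)
    then have "dist (f x) (f y) = norm (a * (x - y) - p *\<^sub>C (x - y)) / cmod w"
      by (simp add: dist_norm norm_scaleC norm_inverse divide_inverse mult.commute)
    also have "\<dots> \<le> \<rho> * norm (x - y) / cmod w"
      by (intro divide_right_mono bound) simp
    finally show ?thesis
      by (simp add: dist_norm)
  qed
  moreover have "\<rho> / cmod w < 1"
    using assms w by (simp add: w_def field_simps)
  ultimately have "\<exists>!y\<in>UNIV. f y = y"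
    using assms(1) by (intro Banach_fix) (auto simp: complete_UNIV)
  then obtain y where "f y = y" by blast
  then have "w *\<^sub>C f y = w *\<^sub>C y" by simp
  then have "a * y - p *\<^sub>C y - a = w *\<^sub>C y"
    using w by (simp add: f_def scaleC_scaleC)
  then have "z *\<^sub>C y - a * y = - a"
    by (simp add: w_def scaleC_simps algebra_simps)
  then show ?thesis ..
qed

text \<open>This supplies discs centred on the imaginary axis for excluding nonreal z. The cross
  terms cancel, leaving \<open>star x * (a * (a * x) + t\<^sup>2 *\<^sub>R x)\<close>.\<close>

lemma norm_self_adjoint_shift_le:
  fixes a :: "'a::cstar_algebra"
  assumes "star a = a"
  shows "norm (a * x + (\<i> * complex_of_real t) *\<^sub>C x) \<le> sqrt ((norm a)\<^sup>2 + t\<^sup>2) * norm x"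
proof (rule power2_le_imp_le)
  let ?u = "a * x + (\<i> * complex_of_real t) *\<^sub>C x"
  have "star ?u * ?u = star x * (a * (a * x) + t\<^sup>2 *\<^sub>R x)"
    by (simp add: star_add star_mult star_scaleC assms algebra_simps scaleC_simps scaleR_scaleC
        power2_eq_square)
  then have "(norm ?u)\<^sup>2 \<le> norm x * norm (a * (a * x) + t\<^sup>2 *\<^sub>R x)"
    by (metis cstar_identity norm_mult_ineq norm_star)
  also have "\<dots> \<le> norm x * (norm a * (norm a * norm x) + t\<^sup>2 * norm x)"
  proof (intro mult_left_mono order_trans [OF norm_triangle_ineq] add_mono)
    show "norm (a * (a * x)) \<le> norm a * (norm a * norm x)"
      by (intro order_trans [OF norm_mult_ineq] mult_left_mono norm_mult_ineq) simp
  qed simp_all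
  finally show "(norm ?u)\<^sup>2 \<le> (sqrt ((norm a)\<^sup>2 + t\<^sup>2) * norm x)\<^sup>2"
    by (simp add: power_mult_distrib) (simp add: power2_eq_square algebra_simps)
qed simp

lemma positive_coneI:
  fixes a :: "'a::cstar_algebra"
  assumes sa: "star a = a" and "s > 0" and bound: "\<And>x. norm (s *\<^sub>R x - a * x) \<le> s * norm x"
  shows "a \<in> positive_cone"
proof -
  have right: "\<exists>y. z *\<^sub>C y - a * y = - a" if z: "z \<notin> \<real>\<^sub>\<ge>\<^sub>0" for z
  proof (cases "Im z = 0")
    case True
    with z have neg: "Re z < 0"
      by (auto simp: complex_nonneg_Reals_iff not_le)
    \<comment> \<open>A negative real lies outside the disc of radius s about s.\<close>
    with True have "cmod (z - complex_of_real s) = s - Re z"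
      using \<open>s > 0\<close> by (simp add: cmod_def)
    moreover have "norm (a * x - complex_of_real s *\<^sub>C x) \<le> s * norm x" for x
      using bound [of x] by (simp add: norm_minus_commute scaleR_scaleC)
    ultimately show ?thesis
      using neg \<open>s > 0\<close> by (intro ex_right_quasi_inverse [of s z "complex_of_real s"]) auto
  next
    case False
    \<comment> \<open>The disc about -it has squared radius |a|^2 + t^2, while |z + it|^2 = |z|^2 +
      2 t Im z + t^2. So 2 t Im z > |a|^2 suffices; the added 1 makes this strict.\<close>
    define t where "t = ((norm a)\<^sup>2 + 1) / (2 * Im z)"
    have "2 * t * Im z = (norm a)\<^sup>2 + 1"
      using False by (simp add: t_def)
    then have "(norm a)\<^sup>2 + t\<^sup>2 < (Re z)\<^sup>2 + (Im z + t)\<^sup>2"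
      unfolding power2_sum by (simp add: algebra_simps add_pos_nonneg)
    then have "sqrt ((norm a)\<^sup>2 + t\<^sup>2) < cmod (z - (- (\<i> * complex_of_real t)))"
      by (simp add: cmod_def)
    then show ?thesis
      using norm_self_adjoint_shift_le [OF sa, of _ t]
      by (intro ex_right_quasi_inverse [of "sqrt ((norm a)\<^sup>2 + t\<^sup>2)" z "- (\<i> * complex_of_real t)"])
        auto
  qed
  have "\<exists>y. quasi_inverse z a y" if z: "z \<notin> \<real>\<^sub>\<ge>\<^sub>0" for z
  proof -
    have "z \<noteq> 0" using z by auto
    have "cnj z \<notin> \<real>\<^sub>\<ge>\<^sub>0"
      using z by (simp add: complex_nonneg_Reals_iff)
    \<comment> \<open>The adjoint of a right solution for the conjugate of z is a left solution for
      z; associativity will show that it equals y.\<close>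
    with z right obtain y v where y: "z *\<^sub>C y - a * y = - a" and "cnj z *\<^sub>C v - a * v = - a"
      by metis
    then have "star (cnj z *\<^sub>C v - a * v) = star (- a)"
      by simp
    then have v: "z *\<^sub>C star v - star v * a = - a"
      by (simp add: star_diff star_scaleC star_mult sa)
    have "star v * (z *\<^sub>C y - a * y) - (z *\<^sub>C star v - star v * a) * y = 0"
      by (simp add: algebra_simps scaleC_simps)
    then have "star v * a = a * y"
      unfolding y v by simp
    with y v have "z *\<^sub>C y = z *\<^sub>C star v"
      by (simp add: diff_eq_eq)
    then have "inverse z *\<^sub>C (z *\<^sub>C y) = inverse z *\<^sub>C (z *\<^sub>C star v)"
      by simp
    then have "y = star v"
      using \<open>z \<noteq> 0\<close> by (simp add: scaleC_scaleC)
    with y v show ?thesis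
      by (auto simp: quasi_inverse_def)
  qed
  with sa show ?thesis
    by (simp add: positive_cone_iff_quasi_inverse)
qed

section \<open>The positive cone\<close>

lemma positive_cone_add:
  fixes a b :: "'a::cstar_algebra"
  assumes "a \<in> positive_cone" "b \<in> positive_cone"
  shows "a + b \<in> positive_cone"
proof (rule positive_coneI)
  \<comment> \<open>The added 1 keeps the shift positive even for the zero element.\<close>
  let ?s = "norm a + 1" and ?t = "norm b + 1"
  show "star (a + b) = a + b"
    using assms by (simp add: star_add positive_cone_def)
  have pos: "?s > 0" "?t > 0"
    by (simp_all add: add_nonneg_pos)
  then show "?s + ?t > 0"
    by (rule add_pos_pos)
  fix x
  have "(?s + ?t) *\<^sub>R x - (a + b) * x = (?s *\<^sub>R x - a * x) + (?t *\<^sub>R x - b * x)"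
    by (simp add: algebra_simps scaleR_2)
  then show "norm ((?s + ?t) *\<^sub>R x - (a + b) * x) \<le> (?s + ?t) * norm x"
    using norm_triangle_ineq [of "?s *\<^sub>R x - a * x" "?t *\<^sub>R x - b * x"]
      positive_cone_norm_le [OF assms(1) pos(1), of x] positive_cone_norm_le [OF assms(2) pos(2), of x]
    by (simp only: distrib_right [of ?s ?t]) simp
qed

lemma positive_cone_scaleR:
  fixes a :: "'a::cstar_algebra"
  assumes "a \<in> positive_cone" "r > 0"
  shows "r *\<^sub>R a \<in> positive_cone"
proof (rule positive_coneI)
  let ?s = "norm a + 1"
  have pos: "?s > 0"
    by (simp add: add_nonneg_pos)
  show "star (r *\<^sub>R a) = r *\<^sub>R a"
    using assms by (simp add: star_scaleR positive_cone_def)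
  show "r * ?s > 0"
    using pos assms by simp
  fix x
  have "(r * ?s) *\<^sub>R x - (r *\<^sub>R a) * x = r *\<^sub>R (?s *\<^sub>R x - a * x)"
    by (simp add: algebra_simps)
  then have "norm ((r * ?s) *\<^sub>R x - (r *\<^sub>R a) * x) = r * norm (?s *\<^sub>R x - a * x)"
    using assms by simp
  also have "\<dots> \<le> r * (?s * norm x)"
    using assms pos by (intro mult_left_mono positive_cone_norm_le) auto
  finally show "norm ((r * ?s) *\<^sub>R x - (r *\<^sub>R a) * x) \<le> (r * ?s) * norm x"
    by (simp only: mult.assoc)
qed

text \<open>With the shift \<open>norm a + 1\<close>, which is continuous in a, the norm criterion
  is an intersection of closed conditions.\<close>

lemma closed_positive_cone: "closed (positive_cone :: 'a::cstar_algebra set)"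
proof -
  have "positive_cone = {a::'a. star a = a} \<inter>
      (\<Inter>x. {a. norm ((norm a + 1) *\<^sub>R x - a * x) \<le> (norm a + 1) * norm x})"
    (is "_ = ?R")
  proof (intro equalityI subsetI)
    fix a :: 'a
    assume "a \<in> positive_cone"
    then show "a \<in> ?R"
      by (auto simp: positive_cone_def add_nonneg_pos intro!: positive_cone_norm_le)
  next
    fix a :: 'a
    assume "a \<in> ?R"
    then show "a \<in> positive_cone"
      by (intro positive_coneI [of a "norm a + 1"]) (auto simp: add_nonneg_pos)
  qed
  moreover have "closed ?R"
    by (intro closed_Int closed_INT ballI closed_Collect_eq closed_Collect_le continuous_intros
        linear_continuous_on bounded_linear_star)
  ultimately show ?thesis by simp
qed

theorem proposition3p4:
  fixes \<phi> :: "'a::cstar_algebra \<Rightarrow> 'b::cstar_algebra"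
  assumes "\<phi> \<in> positive_cone \<rightarrow> positive_cone"
    and "cstar_concave \<phi>"
  shows "cstar_monotone \<phi>"
  unfolding cstar_monotone_def
proof (rule monotone_onI)
  fix x y :: 'a
  assume x: "x \<in> positive_cone" and y: "y \<in> positive_cone" and "x \<preceq> y"
  then have d: "y - x \<in> positive_cone"
    by (simp add: cstar_le_def)
  have mem: "\<phi> y - t *\<^sub>R \<phi> x \<in> positive_cone" if t: "0 \<le> t" "t < 1" for t
  proof -
    define u where "u = x + (1 / (1 - t)) *\<^sub>R (y - x)"
    have u: "u \<in> positive_cone"
      unfolding u_def using t by (intro positive_cone_add positive_cone_scaleR x d) simp
    have "t *\<^sub>R x + (1 - t) *\<^sub>R u = y"
      using t by (simp add: u_def scaleR_add_right) (simp add: algebra_simps)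
    moreover have "t *\<^sub>R \<phi> x + (1 - t) *\<^sub>R \<phi> u \<preceq> \<phi> (t *\<^sub>R x + (1 - t) *\<^sub>R u)"
      using assms(2) x u t unfolding cstar_concave_def by auto
    ultimately have "\<phi> y - (t *\<^sub>R \<phi> x + (1 - t) *\<^sub>R \<phi> u) \<in> positive_cone"
      by (simp add: cstar_le_def)
    \<comment> \<open>Here the positivity of \<open>\<phi> u\<close> enters: adding this term
      cancels the contribution of u and leaves only \<open>t *\<^sub>R \<phi> x\<close>.\<close>
    moreover have "(1 - t) *\<^sub>R \<phi> u \<in> positive_cone"
      using assms(1) u t by (intro positive_cone_scaleR) auto
    ultimately have "\<phi> y - (t *\<^sub>R \<phi> x + (1 - t) *\<^sub>R \<phi> u) + (1 - t) *\<^sub>R \<phi> u \<in> positive_cone"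
      by (rule positive_cone_add)
    then show ?thesis by (simp add: algebra_simps)
  qed
  have "(\<lambda>n. \<phi> y - (real n / real (Suc n)) *\<^sub>R \<phi> x) \<longlonglongrightarrow> \<phi> y - 1 *\<^sub>R \<phi> x"
    by (intro tendsto_intros LIMSEQ_n_over_Suc_n)
  moreover have "\<phi> y - (real n / real (Suc n)) *\<^sub>R \<phi> x \<in> positive_cone" for n
    by (rule mem) auto
  ultimately have "\<phi> y - 1 *\<^sub>R \<phi> x \<in> positive_cone"
    by (rule closed_sequentially [OF closed_positive_cone, rotated])
  then show "\<phi> x \<preceq> \<phi> y"
    by (simp add: cstar_le_def)
qed

end
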